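(* Let $\kappa>0$ and $u_0>0$, and let $u=u(\cdot;u_0):\mathbb{R}\to\mathbb{R}$ be the solution of $$\frac{u''(r)}{(1-u'(r)^2)^{3/2}}=\kappa\,u(r),\qquad u(0)=u_0,\quad u'(0)=0,\quad |u'|<1 .$$ Then $u$ has exactly one minimum, at $r=0$, and $$\lim_{r\to\infty}u(r)=\infty,\qquad \lim_{r\to\infty}u'(r)=1 .$$ Moreover, $u$ is convex and $\lim_{r\to\infty}u''(r)=0$.
   Context: The initial value problem has a unique solution, whose maximal interval of definition is $\mathbb{R}$. *)

theory Defs
  imports "HOL-Analysis.Analysis"
begin

text \<open>Differentiability of \<open>u\<close> and of \<open>u'\<close> is required explicitly because \<^const>\<open>deriv\<close> is an
  unspecified value where no derivative exists. Continuity of \<open>u''\<close> then follows from the equation.\<close>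

definition ivp_solution :: "real \<Rightarrow> real \<Rightarrow> (real \<Rightarrow> real) \<Rightarrow> bool" where
  "ivp_solution \<kappa> u0 u \<longleftrightarrow>
     (\<forall>r. u differentiable (at r)) \<and>
     (\<forall>r. deriv u differentiable (at r)) \<and>
     (\<forall>r. \<bar>deriv u r\<bar> < 1) \<and>
     (\<forall>r. deriv (deriv u) r / (1 - (deriv u r)\<^sup>2) powr (3/2) = \<kappa> * u r) \<and>
     u 0 = u0 \<and> deriv u 0 = 0"

definition local_minimum_at :: "(real \<Rightarrow> real) \<Rightarrow> real \<Rightarrow> bool" where
  "local_minimum_at u r \<longleftrightarrow> (\<forall>\<^sub>F s in nhds r. u r \<le> u s)"

end

theory Submission
  imports Defs "HOL-Real_Asymp.Real_Asymp"
begin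

text \<open>
  The equation is autonomous, and multiplying it by \<open>u'\<close> yields a first integral:
  \<open>1 / sqrt (1 - u'\<^sup>2) - \<kappa> u\<^sup>2 / 2\<close> is constant, so the initial values give
  \<open>1 / sqrt (1 - u'\<^sup>2) = 1 + \<kappa> (u\<^sup>2 - u0\<^sup>2) / 2\<close>. The left-hand side is at least \<open>1\<close>, whence
  \<open>u\<^sup>2 \<ge> u0\<^sup>2\<close>; in particular \<open>u\<close> never vanishes, and by continuity \<open>u \<ge> u0\<close> everywhere
  (lemma \<open>ivp_lower_bound\<close>). The equation then forces \<open>u'' > 0\<close>. So \<open>u\<close> is convex and \<open>u'\<close> is
  strictly increasing with its only zero at \<open>0\<close>, which is therefore the only place for a minimum.

  A convex function with positive slope at \<open>1\<close> lies above a line of positive slope, so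
  \<open>u \<longrightarrow> \<infinity>\<close>. The other two limits come from the first integral: it expresses \<open>1 - u'\<^sup>2\<close>,
  and through the equation also \<open>u''\<close>, as a rational function of \<open>u\<close> that tends to \<open>0\<close>
  as \<open>u \<longrightarrow> \<infinity>\<close>.
\<close>

lemma ivp_DERIV:
  assumes "ivp_solution \<kappa> u0 u"
  shows "(u has_real_derivative deriv u r) (at r)"
    and "(deriv u has_real_derivative deriv (deriv u) r) (at r)"
  using assms unfolding ivp_solution_def
  by (simp_all add: DERIV_deriv_iff_real_differentiable)

lemma ivp_slope_less_1:
  assumes "ivp_solution \<kappa> u0 u"
  shows "0 < 1 - (deriv u r)\<^sup>2"
  using assms unfolding ivp_solution_def by (simp add: abs_square_less_1)

text \<open>The exponent \<open>3/2\<close> is rewritten with the square root that occurs in the first integral.\<close>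

lemma ivp_second_deriv:
  assumes "ivp_solution \<kappa> u0 u"
  shows "deriv (deriv u) r = \<kappa> * u r * sqrt (1 - (deriv u r)\<^sup>2) ^ 3"
proof -
  let ?w = "1 - (deriv u r)\<^sup>2"
  have w: "0 < ?w" using ivp_slope_less_1[OF assms] .
  have "?w powr (3/2) = (?w powr (1/2)) powr real 3"
    by (simp add: powr_powr)
  also have "\<dots> = sqrt ?w ^ 3"
    using w by (subst powr_realpow) (auto simp: powr_half_sqrt)
  finally have "deriv (deriv u) r / sqrt ?w ^ 3 = \<kappa> * u r"
    using assms unfolding ivp_solution_def by metis
  then show ?thesis using w by (simp add: divide_eq_eq)
qed

text \<open>
  The Lorentz factor \<open>1 / sqrt (1 - v\<^sup>2)\<close> has derivative \<open>v / (1 - v\<^sup>2) powr (3/2)\<close>. Along a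
  solution with \<open>v = u'\<close> the chain rule turns this into \<open>\<kappa> u u'\<close>, the derivative of
  \<open>\<kappa> u\<^sup>2 / 2\<close>.
\<close>

lemma ivp_first_integral:
  assumes "ivp_solution \<kappa> u0 u"
  shows "1 / sqrt (1 - (deriv u r)\<^sup>2) = 1 + \<kappa> * ((u r)\<^sup>2 - u0\<^sup>2) / 2"
proof -
  define E where "E = (\<lambda>r. 1 / sqrt (1 - (deriv u r)\<^sup>2) - \<kappa> * (u r)\<^sup>2 / 2)"
  have "(E has_real_derivative 0) (at r)" for r
  proof -
    define s where "s = sqrt (1 - (deriv u r)\<^sup>2)"
    have s: "0 < s" using ivp_slope_less_1[OF assms] by (simp add: s_def)
    have "((\<lambda>r. sqrt (1 - (deriv u r)\<^sup>2)) has_real_derivative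
             - (deriv u r * deriv (deriv u) r) / s) (at r)"
      using ivp_slope_less_1[OF assms, of r] s unfolding s_def
      by (auto intro!: derivative_eq_intros ivp_DERIV[OF assms] simp: field_simps)
    then have "(E has_real_derivative
             deriv u r * deriv (deriv u) r / s ^ 3 - \<kappa> * u r * deriv u r) (at r)"
      using s ivp_slope_less_1[OF assms, of r] unfolding E_def
      by (auto intro!: derivative_eq_intros ivp_DERIV[OF assms]
          simp: s_def[symmetric] field_simps power3_eq_cube)
    moreover have "deriv u r * deriv (deriv u) r / s ^ 3 - \<kappa> * u r * deriv u r = 0"
      using s by (simp add: ivp_second_deriv[OF assms] s_def[symmetric])
    ultimately show ?thesis by simp
  qed
  then have "E r = E 0" by (intro DERIV_isconst_all) auto
  moreover have "E 0 = 1 - \<kappa> * u0\<^sup>2 / 2"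
    using assms by (simp add: E_def ivp_solution_def)
  ultimately show ?thesis by (simp add: E_def field_simps)
qed

text \<open>
  The first integral keeps \<open>u\<close> out of the interval \<open>(-u0, u0)\<close>. As \<open>u\<close> is continuous
  and starts at \<open>u0\<close>, it could only get below this gap by passing through \<open>0\<close>.
\<close>

lemma ivp_lower_bound:
  assumes "\<kappa> > 0" "u0 > 0" and ivp: "ivp_solution \<kappa> u0 u"
  shows "u0 \<le> u r"
proof -
  have sq: "u0\<^sup>2 \<le> (u x)\<^sup>2" for x
  proof -
    have "1 \<le> 1 / sqrt (1 - (deriv u x)\<^sup>2)"
      using ivp_slope_less_1[OF ivp, of x] by simp
    then have "0 \<le> \<kappa> * ((u x)\<^sup>2 - u0\<^sup>2)"
      unfolding ivp_first_integral[OF ivp] by simp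
    then show ?thesis using \<open>\<kappa> > 0\<close> by (simp add: zero_le_mult_iff)
  qed
  have nz: "u x \<noteq> 0" for x using sq[of x] \<open>u0 > 0\<close> by auto
  have cont: "continuous_on UNIV u"
    using DERIV_isCont[OF ivp_DERIV(1)[OF ivp]] by (simp add: continuous_on_eq_continuous_at)
  have "0 < u r"
  proof (rule ccontr)
    assume "\<not> 0 < u r"
    then have "u r \<le> 0" by simp
    have "0 \<le> u 0" using ivp \<open>u0 > 0\<close> by (simp add: ivp_solution_def)
    have "connected (range u)"
      using cont connected_UNIV by (rule connected_continuous_image)
    then have "0 \<in> range u"
      using rangeI rangeI \<open>u r \<le> 0\<close> \<open>0 \<le> u 0\<close> by (rule connectedD_interval)
    then show False using nz by (metis rangeE)
  qed
  then show ?thesis using power2_le_imp_le[OF sq[of r]] by simp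
qed

lemma ivp_deriv_strict_mono:
  assumes "\<kappa> > 0" "u0 > 0" and ivp: "ivp_solution \<kappa> u0 u"
  shows "strict_mono (deriv u)"
proof (rule strict_monoI)
  fix x y :: real
  assume "x < y"
  moreover have "0 < deriv (deriv u) z" for z
    unfolding ivp_second_deriv[OF ivp]
    using assms ivp_lower_bound[OF assms, of z] ivp_slope_less_1[OF ivp, of z] by simp
  ultimately show "deriv u x < deriv u y"
    using ivp_DERIV(2)[OF ivp] by (blast intro: DERIV_pos_imp_increasing)
qed

lemma ivp_convex:
  assumes "\<kappa> > 0" "u0 > 0" "ivp_solution \<kappa> u0 u"
  shows "convex_on UNIV u"
  using ivp_deriv_strict_mono[OF assms] ivp_DERIV(1)[OF assms(3)]
  by (intro convex_on_realI[where f' = "deriv u"]) (auto simp: strict_mono_less_eq)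

lemma ivp_local_minimum_iff:
  assumes "\<kappa> > 0" "u0 > 0" and ivp: "ivp_solution \<kappa> u0 u"
  shows "local_minimum_at u r \<longleftrightarrow> r = 0"
proof
  assume "local_minimum_at u r"
  then obtain d where "d > 0" "\<forall>s. dist s r < d \<longrightarrow> u r \<le> u s"
    unfolding local_minimum_at_def eventually_nhds_metric by blast
  then have "deriv u r = 0"
    using ivp_DERIV(1)[OF ivp, of r] by (intro DERIV_local_min) (auto simp: dist_real_def)
  then have "deriv u r = deriv u 0" using ivp by (simp add: ivp_solution_def)
  then show "r = 0"
    using strict_mono_eq[OF ivp_deriv_strict_mono[OF assms]] by blast
next
  assume "r = 0"
  then show "local_minimum_at u r"
    using ivp_lower_bound[OF assms] ivp by (simp add: local_minimum_at_def ivp_solution_def)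
qed

lemma ivp_arg_min_iff:
  assumes "\<kappa> > 0" "u0 > 0" and ivp: "ivp_solution \<kappa> u0 u"
  shows "is_arg_min u (\<lambda>_. True) r \<longleftrightarrow> r = 0"
proof
  assume "is_arg_min u (\<lambda>_. True) r"
  then have "local_minimum_at u r"
    by (simp add: is_arg_min_linorder local_minimum_at_def)
  then show "r = 0" using ivp_local_minimum_iff[OF assms] by simp
next
  assume "r = 0"
  then show "is_arg_min u (\<lambda>_. True) r"
    using ivp_lower_bound[OF assms] ivp by (simp add: is_arg_min_linorder ivp_solution_def)
qed

lemma ivp_tendsto_infinity:
  assumes "\<kappa> > 0" "u0 > 0" and ivp: "ivp_solution \<kappa> u0 u"
  shows "filterlim u at_top at_top"
proof -
  define c where "c = deriv u 1"
  have "deriv u 0 < c"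
    unfolding c_def using ivp_deriv_strict_mono[OF assms] by (simp add: strict_mono_less)
  then have c: "0 < c" using ivp by (simp add: ivp_solution_def)
  \<comment> \<open>The graph lies above its tangent at \<open>1\<close>; the tangent at \<open>0\<close> is horizontal.\<close>
  have "c * (r - 1) + u 1 \<le> u r" for r
    unfolding c_def
    using convex_on_imp_above_tangent[OF ivp_convex[OF assms] _ _ _ ivp_DERIV(1)[OF ivp], of 1 r]
    by simp
  moreover have "filterlim (\<lambda>r. c * (r - 1) + u 1) at_top at_top"
    using c by real_asymp
  ultimately show ?thesis by (auto intro: filterlim_at_top_mono)
qed

lemma ivp_deriv_tendsto_1:
  assumes "\<kappa> > 0" "u0 > 0" and ivp: "ivp_solution \<kappa> u0 u"
  shows "(deriv u \<longlongrightarrow> 1) at_top"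
proof -
  define g where "g = (\<lambda>x. sqrt (1 - (1 / (1 + \<kappa> * (x\<^sup>2 - u0\<^sup>2) / 2))\<^sup>2))"
  have "(g \<longlongrightarrow> 1) at_top"
    unfolding g_def using \<open>\<kappa> > 0\<close> by real_asymp
  then have lim: "((\<lambda>r. g (u r)) \<longlongrightarrow> 1) at_top"
    by (rule filterlim_compose[OF _ ivp_tendsto_infinity[OF assms]])
  \<comment> \<open>The first integral determines \<open>u'\<close> up to sign, and the sign is positive to the right of \<open>0\<close>.\<close>
  have "deriv u r = g (u r)" if "0 \<le> r" for r
  proof -
    have "deriv u 0 \<le> deriv u r"
      using that ivp_deriv_strict_mono[OF assms] by (simp add: strict_mono_less_eq)
    then have "0 \<le> deriv u r" using ivp by (simp add: ivp_solution_def)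
    moreover have "g (u r) = sqrt ((deriv u r)\<^sup>2)"
      unfolding g_def ivp_first_integral[OF ivp, symmetric]
      using ivp_slope_less_1[OF ivp, of r] by (simp add: power_divide)
    ultimately show ?thesis by simp
  qed
  then have "eventually (\<lambda>r. g (u r) = deriv u r) at_top"
    by (intro eventually_mono[OF eventually_ge_at_top[of 0]]) simp
  then show ?thesis using lim by (rule Lim_transform_eventually[rotated])
qed

lemma ivp_second_deriv_tendsto_0:
  assumes "\<kappa> > 0" "u0 > 0" and ivp: "ivp_solution \<kappa> u0 u"
  shows "(deriv (deriv u) \<longlongrightarrow> 0) at_top"
proof -
  define h where "h = (\<lambda>x. \<kappa> * x * (1 / (1 + \<kappa> * (x\<^sup>2 - u0\<^sup>2) / 2)) ^ 3)"
  have "(h \<longlongrightarrow> 0) at_top"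
    unfolding h_def using \<open>\<kappa> > 0\<close> by real_asymp
  then have "((\<lambda>r. h (u r)) \<longlongrightarrow> 0) at_top"
    by (rule filterlim_compose[OF _ ivp_tendsto_infinity[OF assms]])
  moreover have "deriv (deriv u) = (\<lambda>r. h (u r))"
    unfolding h_def ivp_first_integral[OF ivp, symmetric]
    by (simp add: fun_eq_iff ivp_second_deriv[OF ivp])
  ultimately show ?thesis by simp
qed

theorem theorem4p1:
  fixes \<kappa> u0 :: real and u :: "real \<Rightarrow> real"
  assumes "\<kappa> > 0" and "u0 > 0" and "ivp_solution \<kappa> u0 u"
  shows "(\<forall>r. is_arg_min u (\<lambda>_. True) r \<longleftrightarrow> r = 0) \<and>
         (\<forall>r. local_minimum_at u r \<longleftrightarrow> r = 0) \<and>
         filterlim u at_top at_top \<and>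
         (deriv u \<longlongrightarrow> 1) at_top \<and>
         convex_on UNIV u \<and>
         (deriv (deriv u) \<longlongrightarrow> 0) at_top"
  using ivp_arg_min_iff[OF assms] ivp_local_minimum_iff[OF assms] ivp_tendsto_infinity[OF assms]
    ivp_deriv_tendsto_1[OF assms] ivp_convex[OF assms] ivp_second_deriv_tendsto_0[OF assms]
  by blast

end
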